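(* Let $C$ be an invertible real $n\times n$ matrix, let $\lambda\in\mathbb{R}^n$ be nonzero, and let $\Sigma=\{x\in\mathbb{R}^n:\lambda^\top x=0\}$. Then the dimension of the first-beating set $\Sigma_1$ is $$\dim\Sigma_1=\begin{cases}\dim\Sigma=n-1, & \text{if }\lambda^\top C=\alpha\lambda^\top\text{ for some }\alpha\in\mathbb{R},\\ \dim\Sigma-1=n-2, & \text{otherwise.}\end{cases}$$ Additionally, if $\lambda^\top C=\alpha\lambda^\top$ for some $\alpha\in\mathbb{R}$ (so that $\lambda^\top$ is a left eigenvector of $C$), then $\Sigma_\infty=\Sigma_1$.
   Context: These sets arise from the linear hybrid system $\dot x=Ax$ when $\lambda^\top x\neq 0$, with reset $x^+=Cx$ when $\lambda^\top x=0$, on $\mathbb{R}^n$. For $k\in\mathbb{N}$ the $k$-th beating set is $$\Sigma_k:=\bigcap_{j=0}^{k}\{x\in\mathbb{R}^n:\lambda^\top C^jx=0\},$$ and the blocking set is $\Sigma_\infty:=\bigcap_{k=0}^\infty\Sigma_k$. In particular $\Sigma_0=\Sigma$ and $\Sigma_1=\{x:\lambda^\top x=0=\lambda^\top Cx\}$. *)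

theory Defs
  imports "HOL-Analysis.Analysis"
begin

text \<open>The library's \<open>*\<close> and \<open>^\<close> on the type of matrices act entrywise, so powers with respect to
  the matrix product \<open>**\<close> are introduced here.\<close>

primrec matrix_pow :: "real^'n^'n \<Rightarrow> nat \<Rightarrow> real^'n^'n" where
  "matrix_pow C 0 = mat 1"
| "matrix_pow C (Suc k) = C ** matrix_pow C k"

definition switching_set :: "real^'n \<Rightarrow> (real^'n) set" where
  "switching_set lam = {x. lam \<bullet> x = 0}"

definition beating_set :: "real^'n \<Rightarrow> real^'n^'n \<Rightarrow> nat \<Rightarrow> (real^'n) set" where
  "beating_set lam C k = (\<Inter>j\<in>{0..k}. {x. lam \<bullet> (matrix_pow C j *v x) = 0})"

definition blocking_set :: "real^'n \<Rightarrow> real^'n^'n \<Rightarrow> (real^'n) set" where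
  "blocking_set lam C = (\<Inter>k. beating_set lam C k)"

lemma beating_set_0: "beating_set lam C 0 = switching_set lam"
  by (simp add: beating_set_def switching_set_def)

lemma beating_set_1: "beating_set lam C 1 = {x. lam \<bullet> x = 0 \<and> lam \<bullet> (C *v x) = 0}"
  by (auto simp: beating_set_def atLeast0_atMost_Suc)

end

theory Submission
  imports Defs
begin

text \<open>Since \<open>lam \<bullet> (C *v x) = (lam v* C) \<bullet> x\<close>, the first beating
  set is the orthogonal complement of \<open>lam\<close> and \<open>lam v* C\<close>, so its
  dimension is n minus the rank of this pair (\<open>dim_orthogonal_to_set\<close>). The rank is 1
  if \<open>lam v* C\<close> is a multiple of the nonzero \<open>lam\<close>, and 2 otherwise
  (\<open>dim_beating_set_1\<close>). In the first case every beating set collapses to the switching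
  hyperplane (\<open>beating_set_left_eigenvector\<close>), and so does their intersection.\<close>

lemma dim_orthogonal_to_set:
  fixes S :: "'a::euclidean_space set"
  shows "dim {x. \<forall>a\<in>S. a \<bullet> x = 0} + dim S = DIM('a)"
proof -
  \<comment> \<open>Orthogonality to S extends to its span, a subspace with the same dimension, to
    which the complement formula applies.\<close>
  have "{x. \<forall>a\<in>S. a \<bullet> x = 0} = {x \<in> UNIV. \<forall>a\<in>span S. orthogonal a x}"
    by (auto simp: orthogonal_def span_base)
       (metis orthogonal_commute orthogonal_def orthogonal_to_span)
  then show ?thesis
    using dim_subspace_orthogonal_to_vectors[of "span S" UNIV] by simp
qed

lemma matrix_pow_left_eigenvector:
  assumes "lam v* C = \<alpha> *\<^sub>R lam"
  shows "lam v* matrix_pow C k = \<alpha> ^ k *\<^sub>R lam"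
  by (induction k)
     (simp_all add: assms scaleR_vector_matrix_assoc flip: vector_matrix_mul_assoc)

text \<open>The condition for index j is the one for j = 0 scaled by \<open>\<alpha> ^ j\<close>, so
  j = 0 implies all the others, whatever the value of \<alpha>.\<close>

lemma beating_set_left_eigenvector:
  assumes "lam v* C = \<alpha> *\<^sub>R lam"
  shows "beating_set lam C k = switching_set lam"
proof -
  have "lam \<bullet> (matrix_pow C j *v x) = \<alpha> ^ j * (lam \<bullet> x)" for j x
    by (simp add: matrix_pow_left_eigenvector[OF assms] flip: dot_lmul_matrix)
  then show ?thesis
    by (force simp: beating_set_def switching_set_def)
qed

lemma dim_switching_set:
  fixes lam :: "real^'n"
  assumes "lam \<noteq> 0"
  shows "dim (switching_set lam) + 1 = CARD('n)"
  using dim_orthogonal_to_set[of "{lam}"] assms by (simp add: switching_set_def)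

text \<open>The additive form avoids truncated subtraction on naturals and shows that n is at least
  2 in this case.\<close>

lemma dim_beating_set_1:
  fixes lam :: "real^'n"
  assumes "lam \<noteq> 0" and "\<nexists>\<alpha>. lam v* C = \<alpha> *\<^sub>R lam"
  shows "dim (beating_set lam C 1) + 2 = CARD('n)"
proof -
  have "lam v* C \<notin> span {lam}"
    using assms(2) by (auto simp: span_singleton)
  \<comment> \<open>Inserting a vector outside the span of \<open>lam\<close> adds one to the
    dimension, which is 1 for \<open>{lam}\<close> as \<open>lam\<close> is nonzero.\<close>
  then have "dim {lam v* C, lam} = 2"
    using assms(1) by (simp add: dim_insert)
  moreover have "beating_set lam C 1 = {x. \<forall>a\<in>{lam v* C, lam}. a \<bullet> x = 0}"
    unfolding beating_set_1 by (auto simp: dot_lmul_matrix)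
  ultimately show ?thesis
    using dim_orthogonal_to_set[of "{lam v* C, lam}"] by simp
qed

theorem proposition1:
  fixes C :: "real^'n^'n" and lam :: "real^'n"
  assumes "invertible C" and "lam \<noteq> 0"
  shows "((\<exists>\<alpha>::real. lam v* C = \<alpha> *\<^sub>R lam) \<longrightarrow>
            dim (beating_set lam C 1) = dim (switching_set lam) \<and>
            int (dim (switching_set lam)) = int CARD('n) - 1)
       \<and> (\<not> (\<exists>\<alpha>::real. lam v* C = \<alpha> *\<^sub>R lam) \<longrightarrow>
            int (dim (beating_set lam C 1)) = int (dim (switching_set lam)) - 1 \<and>
            int (dim (switching_set lam)) - 1 = int CARD('n) - 2)
       \<and> ((\<exists>\<alpha>::real. lam v* C = \<alpha> *\<^sub>R lam) \<longrightarrow>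
            blocking_set lam C = beating_set lam C 1)"
proof (intro conjI impI)
  note dims = dim_switching_set[OF assms(2)]
  {
    assume "\<exists>\<alpha>::real. lam v* C = \<alpha> *\<^sub>R lam"
    \<comment> \<open>Having this for every k settles both the dimension (k = 1) and the blocking
      set, an intersection of equal sets.\<close>
    then have *: "beating_set lam C k = switching_set lam" for k
      using beating_set_left_eigenvector by blast
    show "dim (beating_set lam C 1) = dim (switching_set lam)"
      by (simp only: *)
    show "int (dim (switching_set lam)) = int CARD('n) - 1"
      using dims by linarith
    show "blocking_set lam C = beating_set lam C 1"
      by (simp add: blocking_set_def *)
  next
    assume "\<nexists>\<alpha>::real. lam v* C = \<alpha> *\<^sub>R lam"
    note dims1 = dim_beating_set_1[OF assms(2) this]
    show "int (dim (beating_set lam C 1)) = int (dim (switching_set lam)) - 1"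
      using dims dims1 by linarith
    show "int (dim (switching_set lam)) - 1 = int CARD('n) - 2"
      using dims by linarith
  }
qed

end
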